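(* Let $k \in \mathbb{N}$. There is at most one prime $p$ so that $v_p(k+1) \geq e_{p,k}$. In particular, $P_k$ is either $\mathrm{lcm}(1, 2, \ldots, k)$, or $\frac{\mathrm{lcm}(1, 2, \ldots, k)}{p^{e_{p,k}}}$ for some prime $p$.
   Context: $\mathbb{N}$ denotes the nonnegative integers and $\mathbb{N}^* = \mathbb{N} \setminus \{0\}$. For $k \in \mathbb{N}$, the function $g_k : \mathbb{N}^* \to \mathbb{N}^*$ is defined by $g_k(n) = \frac{n(n+1)\cdots(n+k)}{\mathrm{lcm}(n, n+1, \dots, n+k)}$. It is known that $g_k$ is periodic, and $P_k$ denotes its exact (i.e. smallest positive) period: the least positive integer $T$ such that $g_k(n+T) = g_k(n)$ for all $n \in \mathbb{N}^*$. For a prime $p$, $v_p$ denotes the $p$-adic valuation, and $e_{p,k} = \lfloor \log_p(k) \rfloor = \max_{1 \leq i \leq k} v_p(i)$ is the largest exponent of a power of $p$ that is at most $k$.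
   Formalization: The claim "at most one prime p" is proved for primes p ≤ k only; over all primes it is false, since every prime p > k has e_{p,k} = 0 ≤ v_p(k+1). The claim about P_k is proved in full. *)

theory Defs
  imports Complex_Main "HOL-Computational_Algebra.Primes"
begin

text \<open>
  The division is exact, since the product is a multiple of the least common multiple.
  Only arguments \<open>n > 0\<close> are meaningful.
\<close>

definition g_lcm :: "nat \<Rightarrow> nat \<Rightarrow> nat" where
  "g_lcm k n = (\<Prod>i = 0..k. n + i) div Lcm {n..n + k}"

text \<open>\<open>g_lcm k\<close> is periodic on the positive integers, so the least element exists.\<close>

definition exact_period :: "nat \<Rightarrow> nat" where
  "exact_period k = (LEAST T. T > 0 \<and> (\<forall>n>0. g_lcm k (n + T) = g_lcm k n))"

text \<open>
  For \<open>k = 0\<close>, where the logarithm is mathematically undefined, the library convention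
  \<open>log p 0 = 0\<close> gives the value \<open>0\<close>. For a prime \<open>p > k\<close> the value is \<open>0\<close> too, so the
  inequality \<open>max_exp p k \<le> multiplicity p (k + 1)\<close> says something only for primes \<open>p \<le> k\<close>.
\<close>

definition max_exp :: "nat \<Rightarrow> nat \<Rightarrow> nat" where
  "max_exp p k = nat \<lfloor>log (real p) (real k)\<rfloor>"

end

theory Submission
  imports Defs
begin

text \<open>
  Fix a prime \<open>p\<close>, put \<open>e = max_exp p k\<close> and let \<open>v' = min e v\<close> be the truncated \<open>p\<close>-adic
  valuation. Among \<open>n, \<dots>, n + k\<close> some term has \<open>v \<ge> e\<close> and, apart from a term of maximal valuation,
  all have \<open>v \<le> e\<close>; hence \<open>v (g_lcm k n) + e = (\<Sum>i = 0..k. v' (n + i))\<close>. This depends only on \<open>n\<close>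
  modulo \<open>p ^ e\<close>, and is constant if \<open>p ^ e\<close> divides \<open>k + 1\<close>, since its forward difference is
  \<open>v' (n + k + 1) - v' n\<close>. At \<open>n = p ^ e\<close> this difference is \<open>v (k + 1) - e\<close> if \<open>p ^ e\<close> does not
  divide \<open>k + 1\<close>, and it takes this value only at multiples of \<open>p ^ e\<close>, so then \<open>p ^ e\<close> divides every
  period. If distinct primes \<open>r, s \<le> k\<close> with exponents \<open>a, b\<close> both satisfied the divisibility, then
  \<open>r ^ a * s ^ b \<le> k + 1 \<le> s ^ (b + 1)\<close> would give \<open>r \<le> s\<close>, and \<open>s \<le> r\<close> by symmetry.
\<close>

section \<open>The exponent \<open>max_exp\<close>\<close>

lemma max_exp_bounds:
  assumes "prime p" "k > 0"
  shows power_max_exp_le: "p ^ max_exp p k \<le> k"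
    and less_power_Suc_max_exp: "k < p ^ Suc (max_exp p k)"
proof -
  have "real k \<ge> 1" "real p > 1"
    using assms prime_gt_1_nat[of p] by auto
  then have "\<lfloor>log p k\<rfloor> \<ge> 0"
    by simp
  then have "\<lfloor>log p k\<rfloor> = int (max_exp p k)"
    by (simp add: max_exp_def)
  then have "p ^ max_exp p k \<le> k \<and> k < p ^ (max_exp p k + 1)"
    using floor_log_nat_eq_powr_iff[of p k "max_exp p k"] assms prime_ge_2_nat[of p] by blast
  then show "p ^ max_exp p k \<le> k" "k < p ^ Suc (max_exp p k)"
    by auto
qed

lemma max_exp_0 [simp]: "max_exp p 0 = 0"
  by (simp add: max_exp_def log_def)

lemma max_exp_eq_0:
  assumes "prime p" "k < p"
  shows "max_exp p k = 0"
proof (cases "k = 0")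
  case False
  then have "p ^ max_exp p k < p ^ 1"
    using power_max_exp_le[of p k] assms by simp
  then have "max_exp p k < 1"
    using power_less_imp_less_exp prime_gt_1_nat[OF assms(1)] by blast
  then show ?thesis
    by simp
qed simp

text \<open>The bound \<open>k + 1\<close> is the number of terms n, ..., n + k; it also covers
  \<open>k = 0\<close>, where the power is 1.\<close>

lemma power_max_exp_le_Suc: "prime p \<Longrightarrow> p ^ max_exp p k \<le> k + 1"
  using power_max_exp_le[of p k] by (cases "k = 0") auto

lemma multiplicity_le_max_exp:
  assumes "prime p" "0 < i" "i \<le> k"
  shows "multiplicity p i \<le> max_exp p k"
proof -
  have "p ^ multiplicity p i \<le> k"
    using dvd_imp_le[OF multiplicity_dvd, of i p] assms by linarith
  also have "k < p ^ Suc (max_exp p k)"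
    using assms by (intro less_power_Suc_max_exp) auto
  finally have "multiplicity p i < Suc (max_exp p k)"
    using power_less_imp_less_exp prime_gt_1_nat[OF assms(1)] by blast
  then show ?thesis
    by simp
qed

lemma Uniq_prime_max_exp_le_multiplicity_Suc:
  "\<exists>\<^sub>\<le>\<^sub>1 p. prime p \<and> p \<le> k \<and> multiplicity p (k + 1) \<ge> max_exp p k"
proof
  fix p q
  assume p: "prime p \<and> p \<le> k \<and> multiplicity p (k + 1) \<ge> max_exp p k"
    and q: "prime q \<and> q \<le> k \<and> multiplicity q (k + 1) \<ge> max_exp q k"
  have le: "r \<le> s"
    if r: "prime r" "r \<le> k" "multiplicity r (k + 1) \<ge> max_exp r k"
      and s: "prime s" "s \<le> k" "multiplicity s (k + 1) \<ge> max_exp s k" and "r \<noteq> s" for r s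
  proof -
    have "k > 0"
      using r prime_gt_0_nat[of r] by linarith
    \<comment> \<open>Since \<open>r \<le> k\<close>, the exponent is positive, so \<open>r\<close>
      is at most its power.\<close>
    have "multiplicity r r \<le> max_exp r k"
      using r prime_gt_0_nat[of r] by (intro multiplicity_le_max_exp) simp_all
    then have "max_exp r k \<ge> 1"
      using r by simp
    then have "r \<le> r ^ max_exp r k"
      using self_le_power[of r "max_exp r k"] prime_ge_1_nat[OF r(1)] by simp
    have "r ^ max_exp r k dvd k + 1" "s ^ max_exp s k dvd k + 1"
      using r s by (blast intro: multiplicity_dvd')+
    moreover have "coprime (r ^ max_exp r k) (s ^ max_exp s k)"
      using r s \<open>r \<noteq> s\<close> by (simp add: primes_coprime)
    ultimately have "r ^ max_exp r k * s ^ max_exp s k dvd k + 1"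
      by (rule divides_mult)
    then have "r ^ max_exp r k * s ^ max_exp s k \<le> k + 1"
      by (rule dvd_imp_le) simp
    also have "k + 1 \<le> s * s ^ max_exp s k"
      using less_power_Suc_max_exp[of s k] s \<open>k > 0\<close> by simp
    finally have "r ^ max_exp r k \<le> s"
      using prime_gt_0_nat[OF s(1)] by simp
    with \<open>r \<le> r ^ max_exp r k\<close> show ?thesis
      by simp
  qed
  show "p = q"
  proof (rule ccontr)
    assume "p \<noteq> q"
    then have "p \<le> q" "q \<le> p"
      using p q le[of p q] le[of q p] by simp_all
    with \<open>p \<noteq> q\<close> show False
      by simp
  qed
qed

section \<open>Valuations of \<open>g_lcm\<close>\<close>

text \<open>Inserting 0 gives the maximum a value for empty \<open>A\<close>, where the Lcm is
  1.\<close>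

lemma multiplicity_Lcm:
  fixes A :: "nat set"
  assumes "prime p" "finite A" "0 \<notin> A"
  shows "multiplicity p (Lcm A) = Max (insert 0 (multiplicity p ` A))"
  using assms(2,3)
proof (induction A rule: finite_induct)
  case (insert x A)
  then have "multiplicity p (Lcm (insert x A)) = max (multiplicity p x) (multiplicity p (Lcm A))"
    unfolding Lcm_insert using assms(1) by (intro multiplicity_lcm) (auto simp: Lcm_0_iff)
  also have "\<dots> = Max (insert (multiplicity p x) (insert 0 (multiplicity p ` A)))"
    using insert by simp
  finally show ?case
    by (simp only: image_insert insert_commute)
qed simp

lemma multiplicity_Lcm_atLeastAtMost:
  assumes "prime p"
  shows "multiplicity p (Lcm {1..k}) = max_exp p k"
proof (cases "k = 0")
  case False
  have "multiplicity p (Lcm {1..k}) = Max (insert 0 (multiplicity p ` {1..k}))"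
    using assms by (intro multiplicity_Lcm) auto
  also have "\<dots> = max_exp p k"
  proof (rule Max_eqI)
    have "p ^ max_exp p k \<in> {1..k}"
      using assms False prime_gt_0_nat power_max_exp_le[of p k] by (auto simp: Suc_le_eq)
    moreover have "multiplicity p (p ^ max_exp p k) = max_exp p k"
      using assms by simp
    ultimately show "max_exp p k \<in> insert 0 (multiplicity p ` {1..k})"
      by (metis imageI insertCI)
  qed (use assms in \<open>auto simp: multiplicity_le_max_exp\<close>)
  finally show ?thesis .
qed simp

lemma g_lcm_times_Lcm: "g_lcm k n * Lcm {n..n + k} = (\<Prod>i = 0..k. n + i)"
proof -
  have "Lcm {n..n + k} dvd (\<Prod>i = 0..k. n + i)"
  proof (rule Lcm_least)
    fix m
    assume "m \<in> {n..n + k}"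
    then have "m - n \<in> {0..k}" "m = n + (m - n)"
      by auto
    then show "m dvd (\<Prod>i = 0..k. n + i)"
      by (metis dvd_prod_eqI finite_atLeastAtMost)
  qed
  then show ?thesis
    by (simp add: g_lcm_def)
qed

lemma g_lcm_pos:
  assumes "n > 0"
  shows "g_lcm k n > 0"
proof -
  have "g_lcm k n * Lcm {n..n + k} \<noteq> 0"
    using assms by (simp add: g_lcm_times_Lcm)
  then show ?thesis
    by simp
qed

lemma ex_dvd_add:
  fixes d n k :: nat
  assumes "0 < d" "d \<le> k + 1"
  shows "\<exists>i\<le>k. d dvd n + i"
proof -
  \<comment> \<open>The witness is the distance from \<open>n\<close> up to the next multiple of
    \<open>d\<close>. The outer \<open>mod d\<close> turns the distance \<open>d\<close> into 0 when
    \<open>n\<close> is a multiple already, since \<open>d\<close> may be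
    \<open>k + 1\<close>.\<close>
  have "(n + (d - n mod d)) mod d = (n mod d + (d - n mod d)) mod d"
    by (simp add: mod_add_left_eq)
  also have "n mod d + (d - n mod d) = d"
    using mod_less_divisor[OF assms(1), of n] by linarith
  finally have "d dvd n + (d - n mod d) mod d"
    unfolding dvd_eq_mod_eq_0 mod_add_right_eq by simp
  moreover have "(d - n mod d) mod d < d"
    using assms by simp
  then have "(d - n mod d) mod d \<le> k"
    using assms by linarith
  ultimately show ?thesis
    by blast
qed

lemma multiplicity_g_lcm:
  assumes "prime p" "n > 0"
  shows "multiplicity p (g_lcm k n) + max_exp p k =
    (\<Sum>i = 0..k. min (max_exp p k) (multiplicity p (n + i)))"
proof -
  define e where "e = max_exp p k"
  define v where "v i = multiplicity p (n + i)" for i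
  have "Max (v ` {0..k}) \<in> v ` {0..k}"
    by (rule Max_in) auto
  then obtain j where j: "j \<in> {0..k}" and Max_v: "Max (v ` {0..k}) = v j"
    by (rule imageE)
  have v_le: "v i \<le> v j" if "i \<in> {0..k}" for i
    unfolding Max_v[symmetric] using that by simp
  have "p ^ e > 0"
    using assms prime_gt_0_nat by simp
  then obtain i where i: "i \<le> k" "p ^ e dvd n + i"
    using ex_dvd_add power_max_exp_le_Suc assms(1) unfolding e_def by blast
  have "e \<le> v i"
    unfolding v_def using i assms by (intro multiplicity_geI) auto
  then have "e \<le> v j"
    using v_le[of i] i by simp
  have le_e: "v i \<le> e" if "i \<in> {0..k}" "i \<noteq> j" for i
  proof -
    \<comment> \<open>A power of \<open>p\<close> dividing two distinct terms divides their
      difference, which is at most \<open>k\<close>; \<open>max\<close> and \<open>min\<close> keep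
      the subtraction from truncating.\<close>
    define d where "d = max i j - min i j"
    have d: "0 < d" "d \<le> k"
      using that j by (auto simp: d_def max_def min_def)
    have "p ^ v i dvd n + i" "p ^ v i dvd n + j"
      using v_le[OF that(1)] by (auto simp: v_def intro: multiplicity_dvd')
    then have "p ^ v i dvd n + max i j" "p ^ v i dvd n + min i j"
      by (auto simp: max_def min_def)
    then have "p ^ v i dvd (n + max i j) - (n + min i j)"
      by (rule dvd_diff_nat)
    then have "p ^ v i dvd d"
      by (simp add: d_def)
    then have "v i \<le> multiplicity p d"
      using d assms by (intro multiplicity_geI) auto
    also have "\<dots> \<le> e"
      unfolding e_def using assms d by (intro multiplicity_le_max_exp)
    finally show ?thesis .
  qed
  have "multiplicity p (Lcm {n..n + k}) = Max (insert 0 (multiplicity p ` {n..n + k}))"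
    using assms by (intro multiplicity_Lcm) auto
  also have "multiplicity p ` {n..n + k} = v ` {0..k}"
    using image_image[of "multiplicity p" "(+) n" "{0..k}"] by (simp add: v_def add.commute)
  also have "Max (insert 0 (v ` {0..k})) = v j"
    using Max_v by simp
  \<comment> \<open>The Lcm absorbs exactly the term \<open>j\<close>. Truncation leaves the other
    terms unchanged, and the added \<open>e\<close> is the truncated term \<open>j\<close>.\<close>
  finally have "multiplicity p (g_lcm k n) + v j = multiplicity p (g_lcm k n * Lcm {n..n + k})"
    using assms g_lcm_pos[of n k]
    by (subst prime_elem_multiplicity_mult_distrib) (auto simp: Lcm_0_iff)
  also have "\<dots> = (\<Sum>i = 0..k. v i)"
    unfolding g_lcm_times_Lcm v_def using assms
    by (intro prime_elem_multiplicity_prod_distrib) auto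
  also have "\<dots> = v j + (\<Sum>i \<in> {0..k} - {j}. v i)"
    using j by (intro sum.remove) auto
  also have "(\<Sum>i \<in> {0..k} - {j}. v i) = (\<Sum>i \<in> {0..k} - {j}. min e (v i))"
    using le_e by (intro sum.cong) auto
  finally have "multiplicity p (g_lcm k n) + e = min e (v j) + (\<Sum>i \<in> {0..k} - {j}. min e (v i))"
    using \<open>e \<le> v j\<close> by simp
  also have "\<dots> = (\<Sum>i = 0..k. min e (v i))"
    using j by (intro sum.remove[symmetric]) auto
  finally show ?thesis
    by (simp add: e_def v_def)
qed

text \<open>For \<open>j \<le> e\<close>, \<open>p ^ j\<close> divides \<open>x + y\<close> iff it
  divides \<open>x\<close>, so both sides have the same lower bounds. Positivity of \<open>x\<close>
  matters because \<open>multiplicity p 0\<close> is 0 by convention.\<close>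

lemma min_multiplicity_add:
  fixes p x y :: nat
  assumes "prime p" "x > 0" "p ^ e dvd y"
  shows "min e (multiplicity p (x + y)) = min e (multiplicity p x)"
proof -
  have "j \<le> min e (multiplicity p (x + y)) \<longleftrightarrow> j \<le> min e (multiplicity p x)" for j
  proof (cases "j \<le> e")
    case True
    then have "p ^ j dvd y"
      using assms(3) power_le_dvd by blast
    then have "p ^ j dvd x + y \<longleftrightarrow> p ^ j dvd x"
      by (rule dvd_add_left_iff)
    moreover have "\<not> is_unit p"
      using assms by auto
    ultimately show ?thesis
      using assms True by (simp add: power_dvd_iff_le_multiplicity)
  qed simp
  then show ?thesis
    by (meson order_antisym order_refl)
qed

text \<open>The windows starting at \<open>n\<close> and \<open>Suc n\<close> lie in one window of k
  + 2 terms, each missing one end of it. The forward difference is written additively to avoid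
  truncated subtraction.\<close>

lemma multiplicity_g_lcm_Suc:
  assumes "prime p" "n > 0"
  shows "multiplicity p (g_lcm k (Suc n)) + min (max_exp p k) (multiplicity p n) =
    multiplicity p (g_lcm k n) + min (max_exp p k) (multiplicity p (n + (k + 1)))"
proof -
  define w where "w x = min (max_exp p k) (multiplicity p x)" for x
  have "(\<Sum>i = 0..k. w (Suc n + i)) + w n = (\<Sum>i = 0..Suc k. w (n + i))"
    by (subst sum.atLeast0_atMost_Suc_shift) (simp add: add.commute)
  also have "\<dots> = (\<Sum>i = 0..k. w (n + i)) + w (n + (k + 1))"
    by simp
  finally show ?thesis
    using multiplicity_g_lcm[of p n k] multiplicity_g_lcm[of p "Suc n" k] assms
    by (simp add: w_def)
qed

section \<open>Periods of \<open>g_lcm\<close>\<close>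

text \<open>The first alternative serves the primes whose full power divides the period, the second
  those that the period may omit.\<close>

lemma multiplicity_g_lcm_add:
  assumes "prime p" "n > 0" "p ^ max_exp p k dvd T \<or> p ^ max_exp p k dvd k + 1"
  shows "multiplicity p (g_lcm k (n + T)) = multiplicity p (g_lcm k n)"
  using assms(3)
proof
  assume T: "p ^ max_exp p k dvd T"
  have "min (max_exp p k) (multiplicity p (n + T + i)) =
      min (max_exp p k) (multiplicity p (n + i))" for i
    using min_multiplicity_add[OF assms(1) _ T, of "n + i"] assms(2) by (simp add: ac_simps)
  then show ?thesis
    using multiplicity_g_lcm[of p n k] multiplicity_g_lcm[of p "n + T" k] assms by simp
next
  assume dvd: "p ^ max_exp p k dvd k + 1"
  show ?thesis
  proof (induction T)
    case (Suc T)
    have "multiplicity p (g_lcm k (Suc (n + T))) = multiplicity p (g_lcm k (n + T))"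
      using multiplicity_g_lcm_Suc[of p "n + T" k] min_multiplicity_add[OF assms(1) _ dvd] assms
      by simp
    with Suc show ?case
      by simp
  qed simp
qed

lemma power_max_exp_dvd_period:
  assumes "prime p" "max_exp p k > multiplicity p (k + 1)"
    and period: "\<And>n. n > 0 \<Longrightarrow> g_lcm k (n + T) = g_lcm k n"
  shows "p ^ max_exp p k dvd T"
proof (cases "T = 0")
  case False
  define e where "e = max_exp p k"
  define w where "w x = min e (multiplicity p x)" for x
  have "p ^ e > 0"
    using assms prime_gt_0_nat by simp
  \<comment> \<open>The point \<open>p ^ e\<close> stands in for 0, where
    \<open>multiplicity\<close> has the default value 0 and \<open>period\<close> says
    nothing.\<close>
  have w_add: "w (p ^ e + x) = w x" if "x > 0" for x
    using min_multiplicity_add[OF assms(1) that dvd_refl, of e] by (simp add: w_def add.commute)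
  have "w (p ^ e) = e"
    using assms by (simp add: w_def)
  have "w (p ^ e + (k + 1)) = w (k + 1)" "w (p ^ e + T) = w T"
    "w (p ^ e + T + (k + 1)) = w (T + (k + 1))"
    unfolding add.assoc using False by (intro w_add; simp)+
  moreover have "multiplicity p (g_lcm k (Suc n)) + w n =
      multiplicity p (g_lcm k n) + w (n + (k + 1))" if "n > 0" for n
    unfolding w_def e_def using assms(1) that by (rule multiplicity_g_lcm_Suc)
  note this[of "p ^ e"] this[of "p ^ e + T"]
  moreover have "g_lcm k (p ^ e + T) = g_lcm k (p ^ e)"
    "g_lcm k (Suc (p ^ e + T)) = g_lcm k (Suc (p ^ e))"
    using period[of "p ^ e"] period[of "Suc (p ^ e)"] \<open>p ^ e > 0\<close> by auto
  ultimately have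
    "multiplicity p (g_lcm k (Suc (p ^ e))) + e = multiplicity p (g_lcm k (p ^ e)) + w (k + 1)"
    "multiplicity p (g_lcm k (Suc (p ^ e))) + w T = multiplicity p (g_lcm k (p ^ e)) + w (T + (k + 1))"
    using \<open>w (p ^ e) = e\<close> \<open>p ^ e > 0\<close> by (simp_all only: add_gr_0 simp_thms)
  \<comment> \<open>By periodicity the forward differences at \<open>p ^ e\<close> and
    \<open>p ^ e + T\<close> agree; equating them eliminates \<open>g_lcm\<close>.\<close>
  then have "w T + w (k + 1) = w (T + (k + 1)) + e"
    by linarith
  moreover have "w (k + 1) < e"
    using assms by (simp add: w_def e_def)
  \<comment> \<open>With this ultrametric inequality the larger of \<open>w T\<close> and
    \<open>w (k + 1)\<close> is at least \<open>e\<close>, and only \<open>w T\<close> can reach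
    \<open>e\<close>.\<close>
  moreover have "min (w T) (w (k + 1)) \<le> w (T + (k + 1))"
  proof -
    define m where "m = min (w T) (w (k + 1))"
    have "p ^ m dvd T + (k + 1)"
      by (intro dvd_add multiplicity_dvd') (auto simp: m_def w_def)
    then have "m \<le> multiplicity p (T + (k + 1))"
      using assms by (intro multiplicity_geI) auto
    then show ?thesis
      by (simp add: m_def w_def)
  qed
  moreover have "w T \<le> e"
    by (simp add: w_def)
  ultimately have "w T = e"
    by linarith
  then show ?thesis
    by (auto simp: w_def e_def intro: multiplicity_dvd')
qed simp

text \<open>Prime by prime, these valuations make \<open>M\<close> a period and force it to divide
  every period.\<close>

lemma exact_period_eqI:
  assumes "M > 0"
    and M: "\<And>p. prime p \<Longrightarrow> multiplicity p M =
      (if max_exp p k \<le> multiplicity p (k + 1) then 0 else max_exp p k)"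
  shows "exact_period k = M"
  unfolding exact_period_def
proof (rule Least_equality)
  have "g_lcm k (n + M) = g_lcm k n" if "n > 0" for n
  proof -
    have "normalize (g_lcm k (n + M)) = normalize (g_lcm k n)"
    proof (rule multiplicity_eq_imp_eq)
      fix p :: nat
      assume "prime p"
      have "p ^ max_exp p k dvd M \<or> p ^ max_exp p k dvd k + 1"
        using M[OF \<open>prime p\<close>] by (cases "max_exp p k \<le> multiplicity p (k + 1)")
          (auto intro: multiplicity_dvd')
      then show "multiplicity p (g_lcm k (n + M)) = multiplicity p (g_lcm k n)"
        using \<open>prime p\<close> \<open>n > 0\<close> by (intro multiplicity_g_lcm_add)
    qed (use g_lcm_pos[of n k] g_lcm_pos[of "n + M" k] that in auto)
    then show ?thesis
      by simp
  qed
  with \<open>M > 0\<close> show "M > 0 \<and> (\<forall>n>0. g_lcm k (n + M) = g_lcm k n)"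
    by blast
next
  fix T
  assume T: "T > 0 \<and> (\<forall>n>0. g_lcm k (n + T) = g_lcm k n)"
  have "M dvd T"
  proof (rule multiplicity_le_imp_dvd)
    fix p :: nat
    assume "prime p"
    show "multiplicity p M \<le> multiplicity p T"
    proof (cases "max_exp p k \<le> multiplicity p (k + 1)")
      case False
      then have "p ^ max_exp p k dvd T"
        using T \<open>prime p\<close> by (intro power_max_exp_dvd_period) auto
      then have "max_exp p k \<le> multiplicity p T"
        using T \<open>prime p\<close> by (intro multiplicity_geI) auto
      with False show ?thesis
        using M[OF \<open>prime p\<close>] by simp
    qed (use M[OF \<open>prime p\<close>] in simp)
  qed (use assms in simp)
  with T show "M \<le> T"
    by (auto intro: dvd_imp_le)
qed

theorem proposition3p3:
  fixes k :: nat
  shows "(\<exists>\<^sub>\<le>\<^sub>1 p. prime p \<and> p \<le> k \<and> multiplicity p (k + 1) \<ge> max_exp p k) \<and>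
    (exact_period k = Lcm {1..k} \<or> (\<exists>p. prime p \<and> exact_period k = Lcm {1..k} div p ^ max_exp p k))"
proof
  show "\<exists>\<^sub>\<le>\<^sub>1 p. prime p \<and> p \<le> k \<and> multiplicity p (k + 1) \<ge> max_exp p k"
    by (rule Uniq_prime_max_exp_le_multiplicity_Suc)
  define L :: nat where "L = Lcm {1..k}"
  have "L > 0"
    by (auto simp: L_def Lcm_0_iff intro!: Nat.gr0I)
  have mult_L: "multiplicity p L = max_exp p k" if "prime p" for p
    unfolding L_def using that by (rule multiplicity_Lcm_atLeastAtMost)
  show "exact_period k = Lcm {1..k} \<or>
    (\<exists>p. prime p \<and> exact_period k = Lcm {1..k} div p ^ max_exp p k)"
  proof (cases "\<exists>p. prime p \<and> p \<le> k \<and> multiplicity p (k + 1) \<ge> max_exp p k")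
    case False
    \<comment> \<open>For primes above \<open>k\<close> the exponent is 0, so both branches of the
      conditional agree.\<close>
    have "exact_period k = L"
    proof (rule exact_period_eqI)
      fix p :: nat
      assume "prime p"
      then show "multiplicity p L =
          (if max_exp p k \<le> multiplicity p (k + 1) then 0 else max_exp p k)"
        using False mult_L[of p] max_exp_eq_0[of p k] by (auto simp: not_le)
    qed fact
    then show ?thesis
      by (simp add: L_def)
  next
    case True
    then obtain p where p: "prime p" "p \<le> k" "multiplicity p (k + 1) \<ge> max_exp p k"
      by blast
    define M where "M = L div p ^ max_exp p k"
    have "p ^ max_exp p k dvd L"
      using mult_L[OF p(1)] by (auto intro: multiplicity_dvd')
    then have L_eq: "L = p ^ max_exp p k * M"
      by (simp add: M_def)
    have "exact_period k = M"
    proof (rule exact_period_eqI)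
      show "M > 0"
        using \<open>L > 0\<close> L_eq by (auto intro!: Nat.gr0I)
      fix q :: nat
      assume q: "prime q"
      have L_mult: "max_exp q k = multiplicity q (p ^ max_exp p k) + multiplicity q M"
        using mult_L[OF q] q \<open>M > 0\<close> p(1) L_eq by (simp add: prime_elem_multiplicity_mult_distrib)
      show "multiplicity q M = (if max_exp q k \<le> multiplicity q (k + 1) then 0 else max_exp q k)"
      proof (cases "q = p")
        case True
        then show ?thesis
          using L_mult p by simp
      next
        case False
        \<comment> \<open>By uniqueness such a \<open>q\<close> exceeds \<open>k\<close>, so its
          exponent is 0 and only the power of \<open>p\<close> has to be removed.\<close>
        then have "max_exp q k \<le> multiplicity q (k + 1) \<Longrightarrow> max_exp q k = 0"
          using p q Uniq_D[OF Uniq_prime_max_exp_le_multiplicity_Suc, of p k q]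
            max_exp_eq_0[of q k] not_le by blast
        moreover have "multiplicity q (p ^ max_exp p k) = 0"
          using p q False by (simp add: multiplicity_distinct_prime_power)
        ultimately show ?thesis
          using L_mult by auto
      qed
    qed
    then show ?thesis
      using p(1) by (auto simp: M_def L_def)
  qed
qed

end
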